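(* Let $A\in\mathbb{R}^{n\times n}$, $B\in\mathbb{R}^{n\times m}$, $B_1\in\mathbb{R}^{n\times p}$ be constant matrices with $(A,B)$ controllable, and consider the Gauss-Markov model $$dx(t)=Ax(t)\,dt+Bu(t)\,dt+B_1\,dw(t).$$ Assume that $\mathcal{R}(B)\subseteq\mathcal{R}(B_1)$. A symmetric positive definite matrix $\Sigma\in\mathbb{R}^{n\times n}$ can be assigned as the stationary state covariance via a suitable choice of constant state feedback if and only if $\Sigma$ satisfies any of the following equivalent statements: (a) the equation $$A\Sigma+\Sigma A'+B_1B_1'+BX'+XB'=0$$ can be solved for $X\in\mathbb{R}^{n\times m}$; (b) $$\operatorname{rank}\begin{bmatrix}A\Sigma+\Sigma A'+B_1B_1' & B\\ B' & 0\end{bmatrix}=\operatorname{rank}\begin{bmatrix}0 & B\\ B' & 0\end{bmatrix}.$$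
   Context: A prime denotes matrix transpose, $\mathcal{R}(\cdot)$ denotes the range (column space) of a matrix, and $w$ is a standard $p$-dimensional Wiener process. The pair $(A,B)$ is controllable if $[B,\,AB,\ldots,A^{n-1}B]$ has rank $n$. A square matrix is Hurwitz if all its eigenvalues have strictly negative real part. A positive definite matrix $\Sigma$ can be assigned as the stationary state covariance via constant state feedback if there exists $K\in\mathbb{R}^{m\times n}$ such that $A-BK$ is Hurwitz and, with $u(t)=-Kx(t)$, the stationary state process has covariance $\Sigma$, i.e. $$(A-BK)\Sigma+\Sigma(A-BK)'+B_1B_1'=0.$$ *)

theory Defs
  imports "HOL-Analysis.Analysis"
begin

text \<open>
  The columns of \<open>[B, A B, \<dots>, A\<^sup>n\<^sup>-\<^sup>1 B]\<close> are indexed by pairs: \<open>(k, j)\<close> is column \<open>j\<close> of the block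
  whose exponent is the position of \<open>k\<close> under the fixed enumeration \<open>to_nat_on UNIV\<close>, a bijection
  from the type \<open>'n\<close> onto \<open>{..<CARD('n)}\<close>. Powers are iterated \<open>**\<close>, since \<open>^\<close> and \<open>*\<close> act
  componentwise on \<open>vec\<close>.
\<close>

definition controllability_matrix ::
    "real ^ 'n ^ 'n \<Rightarrow> real ^ 'm ^ 'n \<Rightarrow> real ^ ('n \<times> 'm) ^ 'n" where
  "controllability_matrix A B =
     (\<chi> i kj. (((**) A ^^ to_nat_on (UNIV :: 'n set) (fst kj)) B) $ i $ snd kj)"

definition controllable :: "real ^ 'n ^ 'n \<Rightarrow> real ^ 'm ^ 'n \<Rightarrow> bool" where
  "controllable A B \<longleftrightarrow> rank (controllability_matrix A B) = CARD('n)"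

definition eigenvalue :: "'a::field ^ 'n ^ 'n \<Rightarrow> 'a \<Rightarrow> bool" where
  "eigenvalue M l \<longleftrightarrow> (\<exists>v. v \<noteq> 0 \<and> M *v v = l *s v)"

definition hurwitz :: "real ^ 'n ^ 'n \<Rightarrow> bool" where
  "hurwitz M \<longleftrightarrow> (\<forall>l. eigenvalue (map_matrix complex_of_real M) l \<longrightarrow> Re l < 0)"

definition positive_definite :: "real ^ 'n ^ 'n \<Rightarrow> bool" where
  "positive_definite S \<longleftrightarrow> (\<forall>v. v \<noteq> 0 \<longrightarrow> v \<bullet> (S *v v) > 0)"

text \<open>
  Algebraic (Lyapunov) form of: the stationary process of \<open>dx = F x dt + G dw\<close> has covariance \<open>S\<close>.
  It is meant for Hurwitz \<open>F\<close>, where the equation has exactly one solution.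
\<close>

definition stationary_covariance ::
    "real ^ 'n ^ 'n \<Rightarrow> real ^ 'p ^ 'n \<Rightarrow> real ^ 'n ^ 'n \<Rightarrow> bool" where
  "stationary_covariance F G S \<longleftrightarrow> F ** S + S ** transpose F + G ** transpose G = 0"

text \<open>The feedback \<open>u = - K x\<close> turns \<open>dx = A x dt + B u dt + B1 dw\<close> into
  \<open>dx = (A - B K) x dt + B1 dw\<close>.\<close>

definition assignable_covariance ::
    "real ^ 'n ^ 'n \<Rightarrow> real ^ 'm ^ 'n \<Rightarrow> real ^ 'p ^ 'n \<Rightarrow> real ^ 'n ^ 'n \<Rightarrow> bool" where
  "assignable_covariance A B B1 S \<longleftrightarrow>
     (\<exists>K :: real ^ 'n ^ 'm. hurwitz (A - B ** K) \<and> stationary_covariance (A - B ** K) B1 S)"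

definition block_matrix ::
    "'a ^ 'c ^ 'r \<Rightarrow> 'a ^ 'd ^ 'r \<Rightarrow> 'a ^ 'c ^ 's \<Rightarrow> 'a ^ 'd ^ 's \<Rightarrow> 'a ^ ('c + 'd) ^ ('r + 's)" where
  "block_matrix P Q R S =
     (\<chi> i j. case i of
        Inl r \<Rightarrow> (case j of Inl c \<Rightarrow> P $ r $ c | Inr d \<Rightarrow> Q $ r $ d)
      | Inr s \<Rightarrow> (case j of Inl c \<Rightarrow> R $ s $ c | Inr d \<Rightarrow> S $ s $ d))"

end

theory Submission
  imports Defs
begin

text \<open>
  Put \<open>Q = A \<Sigma> + \<Sigma> A' + B1 B1'\<close> and \<open>F = A - B K\<close>. The Lyapunov equation for the closed loop is
  equation (a) with \<open>X = - \<Sigma> K'\<close>, so \<open>K = - X' \<Sigma>\<^sup>-\<^sup>1\<close> solves it, and only stability of \<open>F\<close> is at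
  stake. If \<open>F' v = l v\<close> then \<open>2 Re l (v* \<Sigma> v) = - |B1' v|\<^sup>2\<close>, so \<open>Re l \<le> 0\<close>, and \<open>Re l = 0\<close> forces
  \<open>B1' v = 0\<close>, hence \<open>B' v = 0\<close> by the range inclusion, hence \<open>A' v = l v\<close>, which contradicts
  controllability.

  For (b), let \<open>C\<close> be such that \<open>P = B C\<close> is the orthogonal projection onto the range of \<open>B\<close>.
  Equation (a) is solvable iff \<open>(1 - P) Q (1 - P) = 0\<close>, that is, iff \<open>Q\<close> maps the kernel of \<open>B'\<close>
  into the range of \<open>B\<close>. An invertible shear carries the range of the left block matrix onto a
  subspace that contains the range of the right one, with equality iff this holds.
\<close>

subsection \<open>Block vectors\<close>

definition join_vec :: "'a ^ 'r \<Rightarrow> 'a ^ 's \<Rightarrow> 'a ^ ('r + 's)" where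
  "join_vec x y = (\<chi> i. case i of Inl r \<Rightarrow> x $ r | Inr s \<Rightarrow> y $ s)"

lemma join_vec_cases:
  obtains x y where "v = join_vec x y"
proof
  show "v = join_vec (\<chi> i. v $ Inl i) (\<chi> i. v $ Inr i)"
    by (auto simp: join_vec_def vec_eq_iff split: sum.split)
qed

lemma join_vec_eq_iff [simp]: "join_vec x y = join_vec x' y' \<longleftrightarrow> x = x' \<and> y = y'"
proof
  assume eq: "join_vec x y = join_vec x' y'"
  have "x $ i = x' $ i" for i
    using arg_cong[OF eq, of "\<lambda>v. v $ Inl i"] by (simp add: join_vec_def)
  moreover have "y $ i = y' $ i" for i
    using arg_cong[OF eq, of "\<lambda>v. v $ Inr i"] by (simp add: join_vec_def)
  ultimately show "x = x' \<and> y = y'"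
    by (simp add: vec_eq_iff)
qed simp

lemma block_matrix_mult_join_vec [simp]:
  fixes P :: "'a::semiring_1 ^ 'c ^ 'r"
  shows "block_matrix P Q R S *v join_vec x y = join_vec (P *v x + Q *v y) (R *v x + S *v y)"
proof -
  have "(\<Sum>j\<in>UNIV. f j) = (\<Sum>c\<in>UNIV. f (Inl c)) + (\<Sum>d\<in>UNIV. f (Inr d))"
    for f :: "'c + 'd \<Rightarrow> 'a"
    by (simp add: sum.Plus flip: UNIV_Plus_UNIV)
  then show ?thesis
    by (auto simp: vec_eq_iff block_matrix_def join_vec_def matrix_vector_mult_def split: sum.split)
qed

lemma range_matrix_mult_join_vec:
  fixes M :: "'a::semiring_1 ^ ('c::finite + 'd::finite) ^ 'r"
  shows "range ((*v) M) = {M *v join_vec x y | x y. True}"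
proof (rule set_eqI)
  fix w
  have "(\<exists>v. w = M *v v) \<longleftrightarrow> (\<exists>x y. w = M *v join_vec x y)"
    by (metis join_vec_cases)
  then show "w \<in> range ((*v) M) \<longleftrightarrow> w \<in> {M *v join_vec x y | x y. True}"
    by (simp add: image_iff)
qed

lemma range_block_matrix:
  fixes P :: "'a::semiring_1 ^ 'c ^ 'r"
  shows "range ((*v) (block_matrix P Q R S)) =
    {join_vec (P *v x + Q *v y) (R *v x + S *v y) | x y. True}"
  by (simp add: range_matrix_mult_join_vec)

text \<open>The lower component passes through unchanged, and subtracting \<open>M\<close> times it
  recovers the upper one. Such shears serve below as block row operations that keep the
  rank.\<close>

lemma inj_shear: "inj ((*v) (block_matrix (mat 1) M 0 (mat 1)))"
  for M :: "'a::ring_1 ^ 's ^ 'r"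
proof (rule injI)
  fix v w
  assume "block_matrix (mat 1) M 0 (mat 1) *v v = block_matrix (mat 1) M 0 (mat 1) *v w"
  then show "v = w"
    by (cases v rule: join_vec_cases; cases w rule: join_vec_cases) auto
qed

lemma rank_matrix_mult_inj:
  fixes T :: "real ^ 'b ^ 'c" and M :: "real ^ 'a ^ 'b"
  assumes "inj ((*v) T)"
  shows "rank (T ** M) = rank M"
proof -
  have "range ((*v) (T ** M)) = (*v) T ` range ((*v) M)"
    by (auto simp: image_image simp flip: matrix_vector_mul_assoc)
  moreover have "dim ((*v) T ` range ((*v) M)) = dim (range ((*v) M))"
    by (rule dim_image_eq) (use assms in \<open>auto intro: inj_on_subset\<close>)
  ultimately show ?thesis
    by (simp add: rank_dim_range)
qed

lemma range_eq_of_rank_eq: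
  fixes M N :: "real ^ 'a ^ 'b"
  assumes "range ((*v) M) \<subseteq> range ((*v) N)" and "rank M = rank N"
  shows "range ((*v) M) = range ((*v) N)"
  by (rule subspace_dim_equal)
    (use assms in \<open>auto simp: rank_dim_range intro!: linear_subspace_image\<close>)

declare transpose_matrix_vector [simp del] \<comment> \<open>it rewrites transposed products to \<open>v*\<close>, which blocks associativity\<close>

section \<open>Adjoint, transpose and sign rules for matrices\<close>

lemma inner_matrix_vector_mult: "x \<bullet> (M *v y) = (transpose M *v x) \<bullet> y"
  for M :: "real ^ 'a ^ 'b"
  by (simp add: dot_lmul_matrix transpose_matrix_vector)

lemma transpose_diff: "transpose (M - N) = transpose M - transpose N"
  by (simp add: transpose_def vec_eq_iff)

lemma transpose_uminus: "transpose (- M) = - transpose M"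
  by (simp add: transpose_def vec_eq_iff)

lemma matrix_vector_mult_uminus: "(- M) *v x = - (M *v x)" for M :: "'a::ring_1 ^ 'n ^ 'm"
  by (simp add: matrix_vector_mult_def vec_eq_iff sum_negf)

lemma matrix_mult_uminus:
  fixes M :: "'a::ring_1 ^ 'n ^ 'm"
  shows "M ** (- N) = - (M ** N)" and "(- M) ** N = - (M ** N)"
  by (simp_all add: matrix_matrix_mult_def vec_eq_iff sum_negf)

subsection \<open>Solvability and the rank condition\<close>

text \<open>Normal equations: split \<open>x\<close> into a part in the range of \<open>B\<close>
  and a residual orthogonal to it. \<open>B'\<close> kills the residual, so
  \<open>B' B c = B' x\<close> has a solution.\<close>

lemma exists_projection_onto_range:
  fixes B :: "real ^ 'm ^ 'n"
  obtains C :: "real ^ 'n ^ 'm"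
  where "transpose (B ** C) = B ** C" and "transpose B ** (B ** C) = transpose B"
proof -
  have "\<exists>c. transpose B *v (B *v c) = transpose B *v x" for x
  proof -
    have "subspace (range ((*v) B))"
      by (intro linear_subspace_image) auto
    then obtain y z where yz: "y \<in> range ((*v) B)" "\<And>w. w \<in> range ((*v) B) \<Longrightarrow> orthogonal z w"
      "x = y + z"
      by (metis orthogonal_subspace_decomp_exists span_eq_iff)
    have "(transpose B *v z) \<bullet> (transpose B *v z) = 0"
      using yz(2) by (metis inner_matrix_vector_mult orthogonal_def rangeI)
    then show ?thesis
      using yz(1,3) by (auto simp: matrix_vector_right_distrib)
  qed
  then obtain c where c: "\<And>x. transpose B *v (B *v c x) = transpose B *v x"
    by metis
  \<comment> \<open>\<open>c\<close> is a mere choice function, perhaps not linear; its values on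
    the basis vectors become the columns of a matrix.\<close>
  define C where "C = (\<chi> i j. c (axis j 1) $ i)"
  have col: "M *v (C *v axis j 1) = M *v c (axis j 1)" for M :: "real ^ 'm ^ 'm" and j
    by (rule arg_cong[of _ _ "(*v) M"])
       (simp add: C_def vec_eq_iff matrix_vector_mult_basis column_def)
  have BBC: "transpose B ** (B ** C) = transpose B"
  proof -
    have "column j (transpose B ** (B ** C)) = column j (transpose B)" for j
      using c[of "axis j 1"] col[of "transpose B ** B" j]
      by (simp add: matrix_vector_mul_assoc matrix_mul_assoc flip: matrix_vector_mult_basis)
    then show ?thesis
      by (simp add: column_def vec_eq_iff)
  qed
  have "transpose (B ** C) ** (B ** C) = transpose C ** (transpose B ** (B ** C))"
    by (simp add: matrix_transpose_mul matrix_mul_assoc)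
  also have "\<dots> = transpose (B ** C)"
    by (simp only: BBC) (simp add: matrix_transpose_mul)
  finally have "transpose (B ** C) ** (B ** C) = transpose (B ** C)" .
  \<comment> \<open>The left side is a Gram matrix, hence symmetric, and so is the right
    side.\<close>
  then have "transpose (B ** C) = B ** C"
    by (metis matrix_transpose_mul transpose_transpose)
  with BBC show ?thesis
    using that by blast
qed

lemma solvable_iff_rank:
  fixes Q :: "real ^ 'n ^ 'n" and B :: "real ^ 'm ^ 'n"
  assumes sym: "transpose Q = Q"
  shows "(\<exists>X. Q + B ** transpose X + X ** transpose B = 0) \<longleftrightarrow>
    rank (block_matrix Q B (transpose B) 0) = rank (block_matrix 0 B (transpose B) 0)"
    (is "_ \<longleftrightarrow> rank ?PQ = rank ?P0")
proof
  assume "\<exists>X. Q + B ** transpose X + X ** transpose B = 0"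
  then obtain X where X: "Q + B ** transpose X + X ** transpose B = 0"
    by blast
  \<comment> \<open>The shear adds \<open>X B' x\<close> to \<open>Q x + B y\<close>. By (a) the sum
    is \<open>B (y - X' x)\<close>, and the free vector \<open>y\<close> absorbs the shift.\<close>
  let ?T = "block_matrix (mat 1) X 0 (mat 1)"
  have QX: "Q *v x + X *v (transpose B *v x) = - (B *v (transpose X *v x))" for x
    using arg_cong[OF X, of "\<lambda>M. M *v x"]
    by (simp add: matrix_vector_mult_add_rdistrib matrix_vector_mul_assoc eq_neg_iff_add_eq_0
        algebra_simps)
  have T: "?T *v (?PQ *v join_vec x y) =
      join_vec (B *v (y - transpose X *v x)) (transpose B *v x)" for x y
    using QX[of x] by (simp add: algebra_simps)
  have "range ((*v) (?T ** ?PQ)) = {?T *v (?PQ *v join_vec x y) | x y. True}"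
    unfolding range_matrix_mult_join_vec by (simp only: matrix_vector_mul_assoc)
  also have "\<dots> = {join_vec (B *v (y - transpose X *v x)) (transpose B *v x) | x y. True}"
    by (simp only: T)
  also have "\<dots> = {join_vec (B *v y) (transpose B *v x) | x y. True}" (is "?L = ?R")
  proof
    show "?R \<subseteq> ?L"
    proof
      fix v assume "v \<in> ?R"
      then obtain x y where "v = join_vec (B *v y) (transpose B *v x)"
        by blast
      then have "v = join_vec (B *v ((y + transpose X *v x) - transpose X *v x)) (transpose B *v x)"
        by simp
      then show "v \<in> ?L"
        by blast
    qed
  qed blast
  also have "\<dots> = range ((*v) ?P0)"
    by (simp add: range_block_matrix)
  finally have "rank (?T ** ?PQ) = rank ?P0"
    by (simp add: rank_dim_range)
  then show "rank ?PQ = rank ?P0"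
    by (simp add: rank_matrix_mult_inj inj_shear)
next
  assume rank: "rank ?PQ = rank ?P0"
  obtain C where sym_P: "transpose (B ** C) = B ** C"
    and BP: "transpose B ** (B ** C) = transpose B"
    by (rule exists_projection_onto_range)
  define P where "P = B ** C"
  have P: "transpose P = P" "transpose B ** P = transpose B" "P ** B = B"
    using sym_P BP by (auto simp: P_def) (metis matrix_transpose_mul transpose_transpose)
  have PBv: "P *v (B *v x) = B *v x" "transpose B *v (P *v z) = transpose B *v z" for x z
    using P by (simp_all add: matrix_vector_mul_assoc)
  have PP: "P *v (P *v x) = P *v x" for x
    using PBv(1)[of "C *v x"] by (simp add: P_def matrix_vector_mul_assoc)
  have Ct: "transpose C *v (transpose B *v x) = P *v x" for x
    using sym_P by (simp add: P_def matrix_vector_mul_assoc matrix_transpose_mul)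
  \<comment> \<open>Since \<open>C' B' = P\<close>, this shear replaces \<open>Q\<close> by
    \<open>Q (1 - P)\<close> in the upper left block.\<close>
  let ?T = "block_matrix (mat 1) (- (Q ** transpose C)) 0 (mat 1)"
  have T: "(?T ** ?PQ) *v join_vec x y =
      join_vec (Q *v (x - P *v x) + B *v y) (transpose B *v x)" for x y
    by (simp add: Ct matrix_vector_mult_uminus algebra_simps flip: matrix_vector_mul_assoc)
  have "range ((*v) ?P0) \<subseteq> range ((*v) (?T ** ?PQ))"
  proof
    fix v assume "v \<in> range ((*v) ?P0)"
    then obtain x y where v: "v = join_vec (B *v y) (transpose B *v x)"
      by (auto simp: range_block_matrix)
    \<comment> \<open>Passing from \<open>x\<close> to \<open>P x\<close> makes the \<open>Q\<close>
      term vanish and leaves \<open>B' x\<close> unchanged.\<close>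
    have "v = (?T ** ?PQ) *v join_vec (P *v x) y"
      unfolding T v by (simp add: PP PBv)
    then show "v \<in> range ((*v) (?T ** ?PQ))"
      by blast
  qed
  moreover have "rank ?P0 = rank (?T ** ?PQ)"
    by (simp add: rank rank_matrix_mult_inj inj_shear)
  ultimately have range_eq: "range ((*v) ?P0) = range ((*v) (?T ** ?PQ))"
    by (rule range_eq_of_rank_eq)
  \<comment> \<open>This is \<open>(1 - P) Q (1 - P) = 0\<close>. With second component zero,
    equality of ranges puts \<open>Q (x - P x)\<close> into the range of \<open>B\<close>, where
    \<open>P\<close> is the identity.\<close>
  have PQ: "P *v (Q *v (x - P *v x)) = Q *v (x - P *v x)" for x
  proof -
    have "(?T ** ?PQ) *v join_vec x 0 \<in> range ((*v) ?P0)"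
      unfolding range_eq by blast
    then obtain y where "Q *v (x - P *v x) = B *v y"
      by (auto simp: T range_block_matrix)
    then show ?thesis
      by (simp add: PBv)
  qed
  have "P ** Q - P ** Q ** P = Q - Q ** P"
    unfolding matrix_eq using PQ
    by (simp add: algebra_simps flip: matrix_vector_mul_assoc)
  then have PQP: "P ** Q ** P = P ** Q + Q ** P - Q"
    by (simp add: algebra_simps)
  \<comment> \<open>With \<open>X = Y'\<close>, the term \<open>P Q P\<close> is shared equally between \<open>B X'\<close> and \<open>X B'\<close>.\<close>
  define Y where "Y = (1/2) *\<^sub>R (C ** Q ** P) - C ** Q"
  have BY: "B ** Y = (1/2) *\<^sub>R (P ** Q ** P) - P ** Q"
    unfolding Y_def P_def
    by (simp add: matrix_eq algebra_simps matrix_vector_mult_scaleR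
        flip: matrix_vector_mul_assoc scaleR_matrix_vector_assoc)
  have "transpose Y ** transpose B = transpose (B ** Y)"
    by (simp add: matrix_transpose_mul)
  also have "\<dots> = (1/2) *\<^sub>R (P ** Q ** P) - Q ** P"
    unfolding BY by (simp add: transpose_diff transpose_scalar matrix_transpose_mul P sym
        matrix_mul_assoc)
  finally have YB: "transpose Y ** transpose B = (1/2) *\<^sub>R (P ** Q ** P) - Q ** P" .
  have "Q + B ** transpose (transpose Y) + transpose Y ** transpose B =
      P ** Q ** P - (P ** Q + Q ** P - Q)"
    by (simp add: BY YB)
  also have "\<dots> = 0"
    unfolding PQP by simp
  finally show "\<exists>X. Q + B ** transpose X + X ** transpose B = 0"
    by blast
qed

subsection \<open>Stability of the closed loop\<close>

lemma eigenvalue_iff_not_invertible: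
  fixes M :: "'a::field ^ 'n ^ 'n"
  shows "eigenvalue M l \<longleftrightarrow> \<not> invertible (M - mat l)"
proof -
  have "mat l *v v = l *s v" for v :: "'a ^ 'n"
    by (simp add: vec_eq_iff matrix_vector_mult_def mat_def if_distrib if_distribR cong: if_cong)
  then show ?thesis
    by (auto simp: eigenvalue_def invertible_left_inverse matrix_left_invertible_ker
        matrix_vector_mult_diff_rdistrib)
qed

text \<open>Transposition turns a left inverse into a right inverse, and a one-sided inverse of a
  square matrix is two-sided.\<close>

lemma eigenvalue_transpose [simp]: "eigenvalue (transpose M) l \<longleftrightarrow> eigenvalue M l"
proof -
  have "transpose M - mat l = transpose (M - mat l)"
    by (auto simp: transpose_def mat_def vec_eq_iff)
  then show ?thesis
    by (metis eigenvalue_iff_not_invertible invertible_left_inverse matrix_left_right_inverse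
        left_invertible_transpose)
qed

text \<open>\<open>x\<close> and \<open>y\<close> are the real and imaginary parts of a complex
  eigenvector; with them the stability argument stays within real inner products.\<close>

lemma real_eigenvector_pair:
  fixes M :: "real ^ 'n ^ 'n"
  assumes "eigenvalue (map_matrix complex_of_real M) l"
  obtains x y where "x \<noteq> 0 \<or> y \<noteq> 0"
    and "M *v x = Re l *\<^sub>R x - Im l *\<^sub>R y" and "M *v y = Re l *\<^sub>R y + Im l *\<^sub>R x"
proof -
  obtain v where v: "v \<noteq> 0" "map_matrix complex_of_real M *v v = l *s v"
    using assms by (auto simp: eigenvalue_def)
  then have comp: "(\<Sum>j\<in>UNIV. complex_of_real (M $ i $ j) * v $ j) = l * v $ i" for i
    by (simp add: vec_eq_iff matrix_vector_mult_def)
  show ?thesis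
  proof (rule that)
    show "(\<chi> i. Re (v $ i)) \<noteq> 0 \<or> (\<chi> i. Im (v $ i)) \<noteq> 0"
      using v(1) by (auto simp: vec_eq_iff complex_eq_iff)
    show "M *v (\<chi> i. Re (v $ i)) = Re l *\<^sub>R (\<chi> i. Re (v $ i)) - Im l *\<^sub>R (\<chi> i. Im (v $ i))"
      using arg_cong[OF comp, of Re] by (simp add: vec_eq_iff matrix_vector_mult_def)
    show "M *v (\<chi> i. Im (v $ i)) = Re l *\<^sub>R (\<chi> i. Im (v $ i)) + Im l *\<^sub>R (\<chi> i. Re (v $ i))"
      using arg_cong[OF comp, of Im] by (simp add: vec_eq_iff matrix_vector_mult_def)
  qed
qed

text \<open>By \<open>zero\<close>, \<open>x\<close> is orthogonal to all columns of the
  controllability matrix. Full rank makes these columns span the space, so \<open>x\<close> is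
  orthogonal to itself.\<close>

lemma controllable_left_kernel:
  fixes A :: "real ^ 'n ^ 'n" and B :: "real ^ 'm ^ 'n"
  assumes "controllable A B"
    and zero: "\<And>k. transpose B *v (((*v) (transpose A) ^^ k) x) = 0"
  shows "x = 0"
proof -
  \<comment> \<open>The outermost factor \<open>A\<close> transposes into the innermost
    \<open>A'\<close>, so \<open>z\<close> has to vary in the induction.\<close>
  have power: "transpose (((**) A ^^ k) B) *v z = transpose B *v (((*v) (transpose A) ^^ k) z)" for k z
  proof (induction k arbitrary: z)
    case (Suc k)
    have "transpose (((**) A ^^ Suc k) B) *v z = transpose (((**) A ^^ k) B) *v (transpose A *v z)"
      by (simp add: matrix_transpose_mul matrix_vector_mul_assoc)
    then show ?case
      by (simp only: Suc funpow_Suc_right o_def)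
  qed simp
  have "transpose (controllability_matrix A B) *v x = 0"
  proof -
    have "(transpose (controllability_matrix A B) *v x) $ (k, j) =
        (transpose (((**) A ^^ to_nat_on (UNIV :: 'n set) k) B) *v x) $ j" for k j
      by (simp add: controllability_matrix_def transpose_def matrix_vector_mult_def)
    then show ?thesis
      by (simp add: vec_eq_iff power zero)
  qed
  moreover obtain w where "x = controllability_matrix A B *v w"
    using assms(1) by (metis controllable_def full_rank_surjective surjD)
  ultimately have "x \<bullet> x = 0"
    by (metis inner_matrix_vector_mult inner_zero_left)
  then show ?thesis
    by simp
qed

text \<open>\<open>B B' x\<close> lies in the range of \<open>C\<close>, which is orthogonal to
  \<open>x\<close>; hence \<open>|B' x|^2 = 0\<close>.\<close>

lemma kernel_transpose_antimono:
  fixes B :: "real ^ 'm ^ 'n" and C :: "real ^ 'p ^ 'n"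
  assumes "range ((*v) B) \<subseteq> range ((*v) C)" and "transpose C *v x = 0"
  shows "transpose B *v x = 0"
proof -
  obtain w where "B *v (transpose B *v x) = C *v w"
    using assms(1) by blast
  then have "(transpose B *v x) \<bullet> (transpose B *v x) = 0"
    by (metis assms(2) inner_matrix_vector_mult inner_zero_left)
  then show ?thesis
    by simp
qed

lemma invertible_positive_definite: "invertible S" if "positive_definite S"
  unfolding invertible_left_inverse matrix_left_invertible_ker
  using that by (metis inner_zero_right less_irrefl positive_definite_def)

lemma hurwitz_closed_loop:
  fixes A :: "real ^ 'n ^ 'n" and B :: "real ^ 'm ^ 'n" and B1 :: "real ^ 'p ^ 'n"
  assumes ctrl: "controllable A B"
    and range: "range ((*v) B) \<subseteq> range ((*v) B1)"
    and sym: "transpose S = S"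
    and pd: "positive_definite S"
    and cov: "stationary_covariance (A - B ** K) B1 S"
  shows "hurwitz (A - B ** K)"
  unfolding hurwitz_def
proof (intro allI impI)
  fix l
  let ?F = "A - B ** K"
  assume "eigenvalue (map_matrix complex_of_real ?F) l"
  then have "eigenvalue (transpose (map_matrix complex_of_real ?F)) l"
    by simp
  also have "transpose (map_matrix complex_of_real ?F) = map_matrix complex_of_real (transpose ?F)"
    by (simp add: transpose_def vec_eq_iff)
  finally obtain x y where nz: "x \<noteq> 0 \<or> y \<noteq> 0"
    and Fx: "transpose ?F *v x = Re l *\<^sub>R x - Im l *\<^sub>R y"
    and Fy: "transpose ?F *v y = Re l *\<^sub>R y + Im l *\<^sub>R x"
    by (rule real_eigenvector_pair)
  have S_sym: "u \<bullet> (S *v v) = v \<bullet> (S *v u)" for u v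
    using sym by (metis inner_commute inner_matrix_vector_mult)
  \<comment> \<open>The Lyapunov equation as a quadratic form at \<open>z\<close>; its first two
    terms agree by symmetry of \<open>S\<close>.\<close>
  have quad: "2 * ((transpose ?F *v z) \<bullet> (S *v z)) = - ((transpose B1 *v z) \<bullet> (transpose B1 *v z))" for z
  proof -
    have "z \<bullet> ((?F ** S + S ** transpose ?F + B1 ** transpose B1) *v z) = 0"
      using cov by (simp add: stationary_covariance_def)
    moreover have "z \<bullet> ((?F ** S) *v z) = (transpose ?F *v z) \<bullet> (S *v z)"
      by (metis inner_matrix_vector_mult matrix_vector_mul_assoc)
    moreover have "z \<bullet> ((S ** transpose ?F) *v z) = (transpose ?F *v z) \<bullet> (S *v z)"
      by (metis S_sym matrix_vector_mul_assoc)
    moreover have "z \<bullet> ((B1 ** transpose B1) *v z) = (transpose B1 *v z) \<bullet> (transpose B1 *v z)"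
      by (metis inner_matrix_vector_mult matrix_vector_mul_assoc)
    ultimately show ?thesis
      by (simp add: matrix_vector_mult_add_rdistrib inner_right_distrib)
  qed
  let ?s = "x \<bullet> (S *v x) + y \<bullet> (S *v y)"
  \<comment> \<open>The two cross terms with \<open>Im l\<close> cancel by symmetry of
    \<open>S\<close>; \<open>?s\<close> is \<open>v* S v\<close> for
    \<open>v = x + i y\<close>.\<close>
  have "(transpose ?F *v x) \<bullet> (S *v x) + (transpose ?F *v y) \<bullet> (S *v y) = Re l * ?s"
    unfolding Fx Fy using S_sym[of x y]
    by (simp add: inner_diff_left inner_add_left algebra_simps)
  then have energy: "2 * (Re l * ?s) =
      - ((transpose B1 *v x) \<bullet> (transpose B1 *v x) + (transpose B1 *v y) \<bullet> (transpose B1 *v y))"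
    using quad[of x] quad[of y] by linarith
  have nonneg: "u \<bullet> (S *v u) \<ge> 0" for u
    using pd by (cases "u = 0") (auto simp: positive_definite_def less_imp_le)
  have s_pos: "?s > 0"
    using nz nonneg[of x] nonneg[of y] pd
    by (metis add_nonneg_pos add_pos_nonneg positive_definite_def)
  show "Re l < 0"
  proof (rule ccontr)
    assume "\<not> Re l < 0"
    then have "Re l * ?s \<ge> 0"
      using s_pos by simp
    then have "(transpose B1 *v x) \<bullet> (transpose B1 *v x) + (transpose B1 *v y) \<bullet> (transpose B1 *v y) = 0"
      using energy inner_ge_zero[of "transpose B1 *v x"] inner_ge_zero[of "transpose B1 *v y"]
      by linarith
    then have "transpose B1 *v x = 0 \<and> transpose B1 *v y = 0"
      by (simp add: add_nonneg_eq_0_iff)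
    then have Bxy: "transpose B *v x = 0" "transpose B *v y = 0"
      using kernel_transpose_antimono[OF range] by auto
    \<comment> \<open>On the kernel of \<open>B'\<close> the feedback is invisible:
      \<open>F'\<close> and \<open>A'\<close> agree there.\<close>
    have tF: "transpose ?F *v z = transpose A *v z - transpose K *v (transpose B *v z)" for z
    proof -
      have "transpose ?F = transpose A - transpose K ** transpose B"
        by (simp add: transpose_diff matrix_transpose_mul)
      then show ?thesis
        by (simp add: matrix_vector_mult_diff_rdistrib matrix_vector_mul_assoc)
    qed
    have A: "transpose A *v x = Re l *\<^sub>R x - Im l *\<^sub>R y"
        "transpose A *v y = Re l *\<^sub>R y + Im l *\<^sub>R x"
      using Fx Fy by (simp_all add: tF Bxy)
    have lin: "linear ((*v) (transpose A) ^^ k)" for k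
    proof (induction k)
      case (Suc k)
      then show ?case
        using linear_compose[OF Suc matrix_vector_mul_linear] by (simp only: funpow.simps)
    qed (simp add: linear_ident)
    \<comment> \<open>\<open>A'\<close> maps the span of \<open>x\<close> and \<open>y\<close> into
      itself and \<open>B'\<close> vanishes on that span, hence on all iterates.\<close>
    have "transpose B *v (((*v) (transpose A) ^^ k) x) = 0 \<and>
        transpose B *v (((*v) (transpose A) ^^ k) y) = 0" for k
    proof (induction k)
      case (Suc k)
      then show ?case
        by (simp only: funpow_Suc_right o_def A)
          (simp add: linear_add[OF lin] linear_diff[OF lin] linear_cmul[OF lin]
            matrix_vector_right_distrib matrix_vector_mult_diff_distrib matrix_vector_mult_scaleR)
    qed (simp add: Bxy)
    then have "x = 0" "y = 0"
      using controllable_left_kernel[OF ctrl] by blast+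
    with nz show False
      by simp
  qed
qed

section \<open>From feedback gains to equation (a)\<close>

lemma stationary_covariance_closed_loop_iff:
  fixes A :: "real ^ 'n ^ 'n" and B :: "real ^ 'm ^ 'n" and B1 :: "real ^ 'p ^ 'n"
  assumes "transpose S = S"
  shows "stationary_covariance (A - B ** K) B1 S \<longleftrightarrow>
    A ** S + S ** transpose A + B1 ** transpose B1
      + B ** transpose (- (S ** transpose K)) + (- (S ** transpose K)) ** transpose B = 0"
proof -
  have Xt: "transpose (- (S ** transpose K)) = - (K ** S)"
    by (simp add: transpose_uminus matrix_transpose_mul assms)
  have BX: "B ** (- (K ** S)) = - (B ** K ** S)"
    by (simp add: matrix_mult_uminus matrix_mul_assoc)
  have XB: "(- (S ** transpose K)) ** transpose B = - (S ** transpose K ** transpose B)"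
    by (simp add: matrix_mult_uminus)
  have FS: "(A - B ** K) ** S = A ** S - B ** K ** S"
    by (simp add: matrix_eq algebra_simps flip: matrix_vector_mul_assoc)
  have SF: "S ** transpose (A - B ** K) = S ** transpose A - S ** transpose K ** transpose B"
    by (simp add: transpose_diff matrix_transpose_mul)
      (simp add: matrix_eq algebra_simps flip: matrix_vector_mul_assoc)
  show ?thesis
    unfolding stationary_covariance_def Xt BX XB FS SF by (simp add: algebra_simps)
qed

theorem theorem5:
  fixes A :: "real ^ 'n ^ 'n" and B :: "real ^ 'm ^ 'n" and B1 :: "real ^ 'p ^ 'n"
    and \<Sigma> :: "real ^ 'n ^ 'n"
  assumes "controllable A B"
    and "range ((*v) B) \<subseteq> range ((*v) B1)"
    and "transpose \<Sigma> = \<Sigma>"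
    and "positive_definite \<Sigma>"
  shows
    "(assignable_covariance A B B1 \<Sigma> \<longleftrightarrow>
        (\<exists>X :: real ^ 'm ^ 'n.
           A ** \<Sigma> + \<Sigma> ** transpose A + B1 ** transpose B1 + B ** transpose X + X ** transpose B = 0))
     \<and>
     ((\<exists>X :: real ^ 'm ^ 'n.
           A ** \<Sigma> + \<Sigma> ** transpose A + B1 ** transpose B1 + B ** transpose X + X ** transpose B = 0)
      \<longleftrightarrow>
      rank (block_matrix (A ** \<Sigma> + \<Sigma> ** transpose A + B1 ** transpose B1) B (transpose B) 0)
        = rank (block_matrix 0 B (transpose B) 0))"
proof
  \<comment> \<open>Under the hypotheses, every gain that solves the Lyapunov equation yields a
    Hurwitz closed loop.\<close>
  have "assignable_covariance A B B1 \<Sigma> \<longleftrightarrow> (\<exists>K. stationary_covariance (A - B ** K) B1 \<Sigma>)"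
    unfolding assignable_covariance_def using hurwitz_closed_loop[OF assms] by blast
  also have "\<dots> \<longleftrightarrow> (\<exists>X :: real ^ 'm ^ 'n.
      A ** \<Sigma> + \<Sigma> ** transpose A + B1 ** transpose B1 + B ** transpose X + X ** transpose B = 0)"
    (is "_ \<longleftrightarrow> (\<exists>X. ?eq X)")
  proof -
    obtain R where R: "\<Sigma> ** R = mat 1"
      using invertible_positive_definite[OF assms(4)] by (auto simp: invertible_def)
    \<comment> \<open>The map from \<open>K\<close> to \<open>- \<Sigma> K'\<close> is onto because
      \<open>\<Sigma>\<close> is invertible; \<open>K = - (R X)'\<close> is sent to
      \<open>X\<close>.\<close>
    have "\<exists>K. X = - (\<Sigma> ** transpose K)" for X :: "real ^ 'm ^ 'n"
    proof
      show "X = - (\<Sigma> ** transpose (transpose (- (R ** X))))"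
        by (simp add: matrix_mult_uminus matrix_mul_assoc R)
    qed
    then show ?thesis
      unfolding stationary_covariance_closed_loop_iff[OF assms(3)] by metis
  qed
  finally show "assignable_covariance A B B1 \<Sigma> \<longleftrightarrow> (\<exists>X. ?eq X)" .
  have "transpose (A ** \<Sigma> + \<Sigma> ** transpose A + B1 ** transpose B1) =
      transpose (A ** \<Sigma>) + transpose (\<Sigma> ** transpose A) + transpose (B1 ** transpose B1)"
    by (simp add: transpose_def vec_eq_iff)
  then have "transpose (A ** \<Sigma> + \<Sigma> ** transpose A + B1 ** transpose B1) =
      A ** \<Sigma> + \<Sigma> ** transpose A + B1 ** transpose B1"
    by (simp add: matrix_transpose_mul assms(3) add.commute)
  then show "(\<exists>X. ?eq X) \<longleftrightarrow>
      rank (block_matrix (A ** \<Sigma> + \<Sigma> ** transpose A + B1 ** transpose B1) B (transpose B) 0)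
        = rank (block_matrix 0 B (transpose B) 0)"
    by (rule solvable_iff_rank)
qed

end
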